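(* Let $\theta(q,z):=\sum_{j=0}^{\infty}q^{j(j+1)/2}z^j$ for $q\in(0,1)$, $z\in\mathbb{C}$. (1) For every $q\in(0,1)$, in the region $\operatorname{Re} z\geq 0$ the function $\theta(q,\cdot)$ has no zeros outside the closed half-disk $\{z\in\mathbb{C}:\operatorname{Re} z\geq 0,\ |z|\leq 18\}$. (2) For every $q\in(0,1)$, in the region $\operatorname{Re} z<0$ the function $\theta(q,\cdot)$ has no zeros outside the half-strip $\{z\in\mathbb{C}:\operatorname{Re} z<0,\ |\operatorname{Im} z|\leq 132\}$.
   Context: The series $\theta(q,z)$ is the partial theta function; $q\in(0,1)$ is regarded as a parameter and $z$ as the variable. For each $q\in(0,1)$ it converges for all $z\in\mathbb{C}$ and defines an entire function $\theta(q,\cdot)$. *)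

theory Defs
  imports "HOL-Analysis.Analysis"
begin

definition partial_theta :: "real \<Rightarrow> complex \<Rightarrow> complex" where
  "partial_theta q z = (\<Sum>j. complex_of_real (q ^ (j * (j + 1) div 2)) * z ^ j)"

(* The series converges for every z, so the infinite sum above is never the
   arbitrary value that suminf takes on a divergent series. *)
lemma summable_partial_theta:
  fixes q :: real and z :: complex
  assumes "0 < q" "q < 1"
  shows "summable (\<lambda>j. complex_of_real (q ^ (j * (j + 1) div 2)) * z ^ j)"
proof -
  have "(\<lambda>n. q ^ n * norm z) \<longlonglongrightarrow> 0 * norm z"
    using assms by (intro tendsto_mult LIMSEQ_realpow_zero tendsto_const) auto
  then have "\<forall>\<^sub>F n in sequentially. q ^ n * norm z < 1 / 2"
    by (rule order_tendstoD) simp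
  then obtain N where N: "\<And>n. n \<ge> N \<Longrightarrow> q ^ n * norm z < 1 / 2"
    by (auto simp: eventually_sequentially)
  show ?thesis
  proof (rule summable_ratio_test[of "1 / 2" N])
    fix n assume n: "n \<ge> N"
    have e: "Suc n * (Suc n + 1) div 2 = n * (n + 1) div 2 + Suc n"
    proof -
      have "Suc n * (Suc n + 1) = n * (n + 1) + Suc n * 2" by simp
      then show ?thesis by (metis div_mult_self1 add.commute zero_neq_numeral)
    qed
    have "norm (complex_of_real (q ^ (Suc n * (Suc n + 1) div 2)) * z ^ Suc n)
        = (q ^ Suc n * norm z) * norm (complex_of_real (q ^ (n * (n + 1) div 2)) * z ^ n)"
      unfolding e using assms by (simp add: norm_mult norm_power power_add)
    also have "\<dots> \<le> 1 / 2 * norm (complex_of_real (q ^ (n * (n + 1) div 2)) * z ^ n)"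
      using N[of "Suc n"] n by (intro mult_right_mono) auto
    finally show "norm (complex_of_real (q ^ (Suc n * (Suc n + 1) div 2)) * z ^ Suc n)
        \<le> 1 / 2 * norm (complex_of_real (q ^ (n * (n + 1) div 2)) * z ^ n)" .
  qed simp
qed

end

theory Submission
  imports Defs
begin

text \<open>By Jacobi's triple product, \<open>partial_theta q z + partial_theta q (1 / z) / z\<close> equals the product
  of \<open>(1 - q\<^sup>k) (1 + z q\<^sup>k) (1 + q\<^sup>k\<^sup>-\<^sup>1 / z)\<close> over \<open>k \<ge> 1\<close>, and for \<open>R = cmod z > 1\<close> the second summand is at
  most \<open>1 / (R - 1)\<close> in norm. So at a zero the product is at most \<open>1 / (R - 1)\<close> in norm. With
  \<open>s = q / (1 - q)\<close>, the product of the \<open>1 - q\<^sup>k\<close> is at least \<open>exp (- 5 s / 3)\<close>, because \<open>\<pi>\<^sup>2 / 6 < 5 / 3\<close>.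
  In the right half-plane the factors \<open>sqrt (1 + R\<^sup>2 q\<^sup>2\<^sup>k)\<close> outweigh this. For \<open>cmod (Im z) > 132\<close> the
  factors \<open>1 + z q\<^sup>k\<close> cost at most another \<open>exp (- 10 s / 3)\<close> and a factor \<open>(1 - q) / 2 * 132 / R\<close> from
  the \<open>k\<close> with \<open>R q\<^sup>k\<close> close to 1, while those with \<open>R q\<^sup>k\<close> large more than make up for it.\<close>

section \<open>Gaussian binomial coefficients and the q-binomial theorem\<close>

definition qpoch :: "real \<Rightarrow> nat \<Rightarrow> real" where
  "qpoch q n = (\<Prod>k<n. 1 - q ^ Suc k)"

text \<open>The value 0 for \<open>i > n\<close> makes the q-Pascal rule
  \<open>qbinomial_Suc_Suc\<close> hold for every \<open>i\<close>.\<close>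

definition qbinomial :: "real \<Rightarrow> nat \<Rightarrow> nat \<Rightarrow> real" where
  "qbinomial q n i = (if i \<le> n then qpoch q n / (qpoch q i * qpoch q (n - i)) else 0)"

lemma qpoch_0 [simp]: "qpoch q 0 = 1"
  by (simp add: qpoch_def)

lemma qpoch_Suc: "qpoch q (Suc n) = qpoch q n * (1 - q ^ Suc n)"
  by (simp add: qpoch_def)

lemma qpoch_pos:
  assumes "0 < q" "q < 1"
  shows "0 < qpoch q n"
  unfolding qpoch_def
proof (rule prod_pos, safe)
  fix k
  have "q ^ Suc k < 1"
    using assms by (intro power_Suc_less_one) auto
  then show "0 < 1 - q ^ Suc k" by simp
qed

lemma qpoch_antimono:
  assumes "0 < q" "q < 1" "m \<le> n"
  shows "qpoch q n \<le> qpoch q m"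
  using assms(3)
proof (induction rule: dec_induct)
  case (step n)
  have "qpoch q (Suc n) \<le> qpoch q n"
    unfolding qpoch_Suc using assms qpoch_pos[of q n] by (intro mult_left_le) auto
  then show ?case using step.IH by linarith
qed simp

lemma qbinomial_0 [simp]:
  assumes "0 < q" "q < 1"
  shows "qbinomial q n 0 = 1"
  using qpoch_pos[OF assms, of n] by (simp add: qbinomial_def)

text \<open>The q-Pascal rule. Over a common denominator it is \<open>1 - q ^ (n + 1) = (1 - q ^ (n
  - i)) + q ^ (n - i) * (1 - q ^ (i + 1))\<close>.\<close>

lemma qbinomial_Suc_Suc:
  assumes q: "0 < q" "q < 1"
  shows "qbinomial q (Suc n) (Suc i) = qbinomial q n (Suc i) + q ^ (n - i) * qbinomial q n i"
proof (cases "i < n")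
  case True
  then obtain d where d: "n = Suc (i + d)"
    using less_imp_Suc_add by blast
  have nz: "qpoch q k \<noteq> 0" "1 - q ^ Suc k \<noteq> 0" for k
    using qpoch_pos[OF q, of k] power_Suc_less_one[OF q, of k] by auto
  have e: "qbinomial q n (Suc i) = qpoch q n / (qpoch q i * (1 - q ^ Suc i) * qpoch q d)"
    "qbinomial q n i = qpoch q n / (qpoch q i * (qpoch q d * (1 - q ^ Suc d)))"
    "qbinomial q (Suc n) (Suc i) = qpoch q n * (1 - q ^ (Suc i + Suc d)) /
       (qpoch q i * (1 - q ^ Suc i) * (qpoch q d * (1 - q ^ Suc d)))"
    unfolding qbinomial_def d by (simp_all add: qpoch_Suc Suc_diff_le)
  have "n - i = Suc d" using d by simp
  then show ?thesis
    unfolding e using nz[of i] nz[of d] 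
    by (simp add: divide_simps del: power_Suc) (simp add: algebra_simps power_add)
next
  case False
  then show ?thesis
    using qpoch_pos[OF q, of n] qpoch_pos[OF q, of "Suc n"]
    by (cases "i = n") (auto simp: qbinomial_def)
qed

lemma triangular_Suc: "Suc n * (Suc n + 1) div 2 = n * (n + 1) div 2 + Suc n"
proof -
  have "Suc n * (Suc n + 1) = n * (n + 1) + Suc n * 2" by simp
  then show ?thesis by (metis div_mult_self1 add.commute zero_neq_numeral)
qed

theorem q_binomial_theorem:
  fixes x :: complex
  assumes q: "0 < q" "q < 1"
  shows "(\<Prod>k<n. 1 + x * of_real (q ^ k)) =
    (\<Sum>i\<le>n. of_real (qbinomial q n i * q ^ (i * (i - 1) div 2)) * x ^ i)"
proof (induction n)
  case 0
  then show ?case using q by simp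
next
  case (Suc n)
  let ?t = "\<lambda>i. i * (i - 1) div 2"
  let ?a = "\<lambda>n i. of_real (qbinomial q n i * q ^ ?t i) * x ^ i :: complex"
  have t: "?t (Suc i) = ?t i + i" for i
    using triangular_Suc[of "i - 1"] by (cases i) auto
  have a0: "?a m 0 = 1" for m using q by simp
  have top: "?a n (Suc n) = 0" by (simp add: qbinomial_def)
  \<comment> \<open>Multiplying by the new factor shifts \<open>i\<close> by one; the triangular
    exponent grows by \<open>i\<close>, which turns the weight \<open>q ^ (n - i)\<close> of the
    q-Pascal rule into \<open>q ^ n\<close>.\<close>
  have step: "?a (Suc n) (Suc i) = ?a n (Suc i) + ?a n i * (x * of_real (q ^ n))" if "i \<le> n" for i
  proof -
    have "q ^ (n - i) * q ^ ?t (Suc i) = q ^ n * q ^ ?t i"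
      unfolding t power_add[symmetric] using that by simp
    then have "qbinomial q (Suc n) (Suc i) * q ^ ?t (Suc i)
      = qbinomial q n (Suc i) * q ^ ?t (Suc i) + qbinomial q n i * q ^ ?t i * q ^ n"
      unfolding qbinomial_Suc_Suc[OF q] by (simp add: algebra_simps)
    then show ?thesis 
      by (simp only: of_real_add of_real_mult power_Suc) (simp add: algebra_simps)
  qed
  have "(\<Sum>i\<le>Suc n. ?a (Suc n) i) = ?a n 0 + (\<Sum>i\<le>n. ?a (Suc n) (Suc i))"
    unfolding sum.atMost_Suc_shift a0 ..
  also have "(\<Sum>i\<le>n. ?a (Suc n) (Suc i)) =
      (\<Sum>i\<le>n. ?a n (Suc i)) + (\<Sum>i\<le>n. ?a n i) * (x * of_real (q ^ n))"
    using step by (simp only: sum_distrib_right sum.distrib[symmetric]) (rule sum.cong, auto)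
  also have "?a n 0 + \<dots> = (\<Sum>i\<le>Suc n. ?a n i) + (\<Sum>i\<le>n. ?a n i) * (x * of_real (q ^ n))"
    unfolding sum.atMost_Suc_shift by (simp only: add.assoc)
  also have "(\<Sum>i\<le>Suc n. ?a n i) = (\<Sum>i\<le>n. ?a n i)"
    unfolding sum.atMost_Suc top by simp
  also have "\<dots> + \<dots> * (x * of_real (q ^ n)) = \<dots> * (1 + x * of_real (q ^ n))"
    by (simp add: algebra_simps)
  finally show ?case
    unfolding prod.lessThan_Suc Suc.IH by simp
qed

section \<open>Finite form of Jacobi's triple product\<close>

lemma prod_lessThan_add:
  fixes f :: "nat \<Rightarrow> 'a :: comm_monoid_mult"
  shows "(\<Prod>k<m + n. f k) = (\<Prod>k<m. f k) * (\<Prod>k<n. f (m + k))"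
  by (induction n) (auto simp: mult.assoc)

text \<open>Recentres the sum at \<open>m\<close> and reverses the lower part, so that nonnegative
  and negative powers of \<open>z\<close> separate.\<close>

lemma sum_atMost_split:
  fixes f :: "nat \<Rightarrow> 'a :: comm_monoid_add"
  shows "(\<Sum>i\<le>m + n. f i) = (\<Sum>j\<le>n. f (m + j)) + (\<Sum>j<m. f (m - Suc j))"
proof -
  have "(\<Sum>i\<le>m + n. f i) = (\<Sum>i<m. f i) + (\<Sum>j\<le>n. f (m + j))"
    by (induction n) (auto simp: add.assoc lessThan_Suc_atMost[symmetric])
  then show ?thesis
    by (simp only: sum.nat_diff_reindex add.commute)
qed

definition theta_prod :: "real \<Rightarrow> complex \<Rightarrow> nat \<Rightarrow> complex" where
  "theta_prod q z n =
    (\<Prod>k<n. of_real (1 - q ^ Suc k) * (1 + z * of_real (q ^ Suc k)) * (1 + of_real (q ^ k) / z))"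

text \<open>Index \<open>n + j\<close> belongs to the power \<open>z ^ j\<close> in
  \<open>theta_prod q z n\<close>, and index \<open>n - Suc j\<close> to
  \<open>1 / z ^ Suc j\<close>; the triangular power of \<open>q\<close> is kept apart.\<close>

definition theta_coeff :: "real \<Rightarrow> nat \<Rightarrow> nat \<Rightarrow> real" where
  "theta_coeff q n i = qpoch q n * qbinomial q (2 * n) i"

lemma theta_prod_eq_sum:
  assumes q: "0 < q" "q < 1" and z: "z \<noteq> 0"
  shows "theta_prod q z n =
    (\<Sum>j\<le>n. of_real (theta_coeff q n (n + j) * q ^ (j * (j + 1) div 2)) * z ^ j) +
    (\<Sum>j<n. of_real (theta_coeff q n (n - Suc j) * q ^ (j * (j + 1) div 2)) / z ^ Suc j)"
proof -
  define t where "t i = i * (i - 1) div 2" for i :: nat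
  let ?q = "of_real q :: complex"
  let ?D = "z ^ n / ?q ^ (t n)"
  let ?x = "z * ?q / ?q ^ n" \<comment> \<open>at this point the \<open>q\<close>-binomial product with \<open>2 * n\<close> factors splits into both halves\<close>
  have qz: "?q \<noteq> 0" using q by simp
  have D0: "?D \<noteq> 0" using qz z by simp
  have t: "t (Suc i) = t i + i" for i
    using triangular_Suc[of "i - 1"] by (cases i) (auto simp: t_def)
  have tt: "j * (j + 1) div 2 = t (Suc j)" for j by (simp add: t_def mult.commute)
  \<comment> \<open>In reverse order these factors are \<open>1 + z / q ^ k\<close>. Pulling out
    \<open>z / q ^ k\<close> leaves \<open>1 + q ^ k / z\<close>, and the extracted parts multiply
    to \<open>?D\<close>.\<close>
  have lower: "(\<Prod>k<n. 1 + ?x * of_real (q ^ k)) = ?D * (\<Prod>k<n. 1 + of_real (q ^ k) / z)"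
  proof -
    have "(\<Prod>k<n. 1 + ?x * of_real (q ^ k)) = (\<Prod>k<n. 1 + ?x * of_real (q ^ (n - Suc k)))"
      by (rule prod.nat_diff_reindex[symmetric])
    also have "\<dots> = (\<Prod>k<n. (z / ?q ^ k) * (1 + of_real (q ^ k) / z))"
    proof (rule prod.cong[OF refl])
      fix k assume "k \<in> {..<n}"
      then have "?q ^ n = ?q ^ (n - Suc k) * ?q * ?q ^ k"
        by (simp add: power_add[symmetric] power_Suc2[symmetric] del: power_Suc)
      then show "1 + ?x * of_real (q ^ (n - Suc k)) = (z / ?q ^ k) * (1 + of_real (q ^ k) / z)"
        using qz z by (simp add: field_simps)
    qed
    also have "\<dots> = (\<Prod>k<n. z / ?q ^ k) * (\<Prod>k<n. 1 + of_real (q ^ k) / z)"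
      by (rule prod.distrib)
    also have "(\<Prod>k<n. z / ?q ^ k) = ?D"
      by (induction n) (auto simp: t_def[of 0] t power_add mult.commute)
    finally show ?thesis .
  qed
  have upper: "(\<Prod>k<n. 1 + ?x * of_real (q ^ (n + k))) = (\<Prod>k<n. 1 + z * of_real (q ^ Suc k))"
    using qz by (intro prod.cong) (auto simp: power_add field_simps)
  have t2: "t m + t m = m * (m - 1)" for m
  proof (induction m)
    case (Suc m)
    then show ?case by (cases m) (auto simp: t)
  qed (simp add: t_def)
  \<comment> \<open>The exponents of \<open>q\<close> are balanced without subtraction, since
    subtraction on naturals truncates; \<open>exp2\<close> does the same for the negative powers,
    with \<open>n = m + Suc j\<close>.\<close>
  have exp1: "t (n + j) + (n + j) + t n = t (Suc j) + n * (n + j)" for j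
  proof (induction j)
    case 0
    show ?case using t2[of n] t[of 0] by (cases n) (auto simp: t_def[of 0])
  next
    case (Suc j)
    then show ?case by (simp only: add_Suc_right t) (simp add: algebra_simps)
  qed
  have exp2: "t m + m + t (m + Suc j) = t (Suc j) + (m + Suc j) * m" for m j
  proof (induction j)
    case 0
    show ?case using t2[of m] t[of m] t[of 0] by (cases m) (auto simp: t_def[of 0])
  next
    case (Suc j)
    then show ?case by (simp only: add_Suc_right t) (simp add: algebra_simps)
  qed
  have term1: "of_real (q ^ t (n + j)) * ?x ^ (n + j) = ?D * (?q ^ t (Suc j) * z ^ j)" for j
  proof -
    have "?q ^ t (n + j) * ?q ^ (n + j) * ?q ^ t n = ?q ^ t (Suc j) * ?q ^ (n * (n + j))"
      unfolding power_add[symmetric] exp1 ..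
    then show ?thesis
      using qz by (simp add: power_divide power_mult_distrib power_mult[symmetric] divide_simps)
        (simp add: power_add mult_ac)
  qed
  have term2: "of_real (q ^ t (n - Suc j)) * ?x ^ (n - Suc j) = ?D * (?q ^ t (Suc j) / z ^ Suc j)"
    if "j < n" for j
  proof -
    define m where "m = n - Suc j"
    then have m: "n = m + Suc j" "n - Suc j = m" using that by simp_all
    have "?q ^ t m * ?q ^ m * ?q ^ t n = ?q ^ t (Suc j) * ?q ^ (n * m)"
      unfolding power_add[symmetric] m(1) exp2 ..
    moreover have "z ^ n = z ^ m * z ^ Suc j" unfolding m by (rule power_add)
    moreover have "?x ^ m = z ^ m * ?q ^ m / ?q ^ (n * m)"
      by (simp add: power_divide power_mult_distrib power_mult[symmetric])
    ultimately show ?thesis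
      using qz z unfolding m(2) by (simp add: divide_simps del: power_Suc) (simp only: mult_ac)
  qed
  let ?b = "\<lambda>i. of_real (qbinomial q (2 * n) i) :: complex"
  have "?D * ((\<Prod>k<n. 1 + of_real (q ^ k) / z) * (\<Prod>k<n. 1 + z * of_real (q ^ Suc k))) =
      (\<Prod>k<n + n. 1 + ?x * of_real (q ^ k))"
    unfolding prod_lessThan_add lower upper by (simp add: mult.assoc)
  also have "\<dots> = (\<Sum>i\<le>n + n. ?b i * (of_real (q ^ t i) * ?x ^ i))"
    unfolding q_binomial_theorem[OF q] mult_2 t_def by (simp only: of_real_mult mult.assoc)
  also have "\<dots> = (\<Sum>j\<le>n. ?b (n + j) * (of_real (q ^ t (n + j)) * ?x ^ (n + j))) +
      (\<Sum>j<n. ?b (n - Suc j) * (of_real (q ^ t (n - Suc j)) * ?x ^ (n - Suc j)))"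
    by (rule sum_atMost_split)
  also have "\<dots> = ?D * ((\<Sum>j\<le>n. ?b (n + j) * (?q ^ t (Suc j) * z ^ j)) +
      (\<Sum>j<n. ?b (n - Suc j) * (?q ^ t (Suc j) / z ^ Suc j)))"
    unfolding distrib_left sum_distrib_left
    by (intro arg_cong2[where f = "(+)"] sum.cong refl)
      (simp_all only: term1 term2 lessThan_iff mult.left_commute)
  finally have main: "(\<Prod>k<n. 1 + of_real (q ^ k) / z) * (\<Prod>k<n. 1 + z * of_real (q ^ Suc k)) =
      (\<Sum>j\<le>n. ?b (n + j) * (?q ^ t (Suc j) * z ^ j)) +
      (\<Sum>j<n. ?b (n - Suc j) * (?q ^ t (Suc j) / z ^ Suc j))"
    unfolding mult_left_cancel[OF D0] .
  have "theta_prod q z n = of_real (qpoch q n) *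
      ((\<Prod>k<n. 1 + of_real (q ^ k) / z) * (\<Prod>k<n. 1 + z * of_real (q ^ Suc k)))"
    unfolding theta_prod_def qpoch_def of_real_prod prod.distrib by (simp only: mult_ac)
  then show ?thesis
    unfolding main tt unfolding theta_coeff_def of_real_mult of_real_power distrib_left sum_distrib_left
    by (simp only: mult.assoc times_divide_eq_right)
qed

section \<open>Passage to the limit in the triple product\<close>

text \<open>One of \<open>i\<close>, \<open>2 * n - i\<close> is at most \<open>n\<close> and the
  other at most \<open>2 * n\<close>. As \<open>qpoch q\<close> decreases, each factor of the
  numerator is at most a factor of the denominator.\<close>

lemma theta_coeff_bounds:
  assumes q: "0 < q" "q < 1" and "i \<le> 2 * n"
  shows "0 \<le> theta_coeff q n i" "theta_coeff q n i \<le> 1"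
proof -
  note pos = qpoch_pos[OF q]
  have e: "theta_coeff q n i = qpoch q n * qpoch q (2 * n) / (qpoch q i * qpoch q (2 * n - i))"
    using assms(3) by (simp add: theta_coeff_def qbinomial_def)
  show "0 \<le> theta_coeff q n i"
    unfolding e using pos by (simp add: less_imp_le)
  have "qpoch q n * qpoch q (2 * n) \<le> qpoch q i * qpoch q (2 * n - i)"
  proof (cases "i \<le> n")
    case True
    then have "qpoch q n \<le> qpoch q i" "qpoch q (2 * n) \<le> qpoch q (2 * n - i)"
      by (auto intro!: qpoch_antimono q)
    then show ?thesis using pos by (intro mult_mono) (auto simp: less_imp_le)
  next
    case False
    then have "qpoch q n \<le> qpoch q (2 * n - i)" "qpoch q (2 * n) \<le> qpoch q i"
      using assms(3) by (auto intro!: qpoch_antimono q)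
    then have "qpoch q n * qpoch q (2 * n) \<le> qpoch q (2 * n - i) * qpoch q i" 
      using pos by (intro mult_mono) (auto simp: less_imp_le)
    then show ?thesis by (simp only: mult.commute)
  qed
  then show "theta_coeff q n i \<le> 1"
    unfolding e using pos by (simp add: divide_simps mult_pos_pos)
qed

text \<open>Expand each \<open>- ln (1 - q ^ k)\<close> as a power series and interchange the sums:
  the \<open>m\<close>-th term is at most \<open>q ^ m / (m * (1 - q ^ m))\<close>, hence at most
  \<open>s / m ^ 2\<close>, and these add up to \<open>s * pi ^ 2 / 6\<close>.\<close>

lemma qpoch_ge:
  assumes q: "0 < q" "q < 1"
  shows "exp (- (5 / 3) * (q / (1 - q))) \<le> qpoch q n"
proof -
  define s where "s = q / (1 - q)"
  have s0: "0 \<le> s" using q by (simp add: s_def)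
  have ln_sums: "(\<lambda>m. x ^ Suc m / real (Suc m)) sums (- ln (1 - x))" if "0 < x" "x < 1" for x :: real
    using sums_minus[OF ln_series'[of "- x"]] that
      sums_Suc_iff[of "\<lambda>n. x ^ n / real n" "- ln (1 - x)"] by simp
  have sq: "(\<lambda>m. s * (1 / (1 + real m)\<^sup>2)) sums (s * (pi\<^sup>2 / 6))"
    using inverse_squares_sums by (intro sums_mult) (simp add: add.commute)
  have xk: "0 < q ^ Suc k" "q ^ Suc k < 1" for k
    using q power_Suc_less_one[OF q] by auto
  have "(\<lambda>m. \<Sum>k<n. (q ^ Suc k) ^ Suc m / real (Suc m)) sums (\<Sum>k<n. - ln (1 - q ^ Suc k))"
    by (intro sums_sum ln_sums xk)
  moreover have "(\<Sum>k<n. (q ^ Suc k) ^ Suc m / real (Suc m)) \<le> s * (1 / (1 + real m)\<^sup>2)" for m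
  proof -
    let ?p = "q ^ Suc m"
    have p: "0 < ?p" "?p < 1" by (rule xk)+
    have "(\<Sum>k<n. (q ^ Suc k) ^ Suc m) = ?p * (\<Sum>k<n. ?p ^ k)"
      by (simp only: sum_distrib_left power_mult[symmetric] power_add[symmetric] mult_Suc mult.commute)
    also have "(\<Sum>k<n. ?p ^ k) \<le> 1 / (1 - ?p)"
    proof -
      have "(\<Sum>k<n. ?p ^ k) = (1 - ?p ^ n) / (1 - ?p)"
        using p by (simp add: sum_gp_strict del: power_Suc)
      also have "\<dots> \<le> 1 / (1 - ?p)"
        using p by (intro divide_right_mono) (auto simp del: power_Suc)
      finally show ?thesis .
    qed
    finally have 1: "(\<Sum>k<n. (q ^ Suc k) ^ Suc m) \<le> ?p / (1 - ?p)"
      using p by (simp add: mult_left_mono del: power_Suc)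
    \<comment> \<open>Each of the \<open>m + 1\<close> summands is at least the last one; this
      bounds \<open>1 - q ^ Suc m\<close> below by a multiple of \<open>1 - q\<close>.\<close>
    have "real (Suc m) * q ^ m \<le> (\<Sum>i<Suc m. q ^ i)"
      using sum_bounded_below[of "{..<Suc m}" "q ^ m" "\<lambda>i. q ^ i"] q
      by (auto intro: power_decreasing simp del: sum.lessThan_Suc)
    then have "real (Suc m) * q ^ m * (1 - q) \<le> 1 - ?p"
      using q by (simp add: sum_gp_strict field_simps)
    then have "?p / (1 - ?p) \<le> s / real (Suc m)"
      using p q unfolding s_def by (simp add: divide_simps mult_ac)
    with 1 have "(\<Sum>k<n. (q ^ Suc k) ^ Suc m) / real (Suc m) \<le> s / real (Suc m) / real (Suc m)"
      by (intro divide_right_mono) auto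
    then show ?thesis by (simp add: sum_divide_distrib power2_eq_square add.commute)
  qed
  ultimately have "(\<Sum>k<n. - ln (1 - q ^ Suc k)) \<le> s * (pi\<^sup>2 / 6)"
    by (rule sums_le[OF _ _ sq, rotated])
  also have "\<dots> \<le> s * (5 / 3)"
  proof -
    have "pi\<^sup>2 \<le> 3.15\<^sup>2" using pi_approx by (intro power_mono) auto
    then show ?thesis using s0 by (intro mult_left_mono) (auto simp: power2_eq_square)
  qed
  finally have "- (5 / 3) * s \<le> (\<Sum>k<n. ln (1 - q ^ Suc k))" by (simp add: sum_negf)
  also have "\<dots> = ln (qpoch q n)"
    unfolding qpoch_def using xk by (subst ln_prod) (auto simp: less_le simp del: power_Suc)
  finally show ?thesis
    using qpoch_pos[OF q] unfolding s_def by (simp add: ln_ge_iff)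
qed

text \<open>All four \<open>qpoch\<close> terms tend to the same limit \<open>L\<close>, so the
  quotient tends to 1 once \<open>L\<close> is nonzero, which \<open>qpoch_ge\<close>
  provides.\<close>

lemma theta_coeff_tendsto:
  assumes q: "0 < q" "q < 1"
  shows "(\<lambda>n. theta_coeff q n (n + j)) \<longlonglongrightarrow> 1"
    and "(\<lambda>n. theta_coeff q n (n - j)) \<longlonglongrightarrow> 1"
proof -
  have "decseq (qpoch q)"
    using qpoch_antimono[OF q] by (auto simp: decseq_def)
  then obtain L where L: "qpoch q \<longlonglongrightarrow> L" "\<And>i. L \<le> qpoch q i"
    using decseq_convergent[of "qpoch q" 0] qpoch_pos[OF q] by (metis less_imp_le)
  have "exp (- (5 / 3) * (q / (1 - q))) \<le> L"
    using qpoch_ge[OF q] by (intro LIMSEQ_le_const[OF L(1)]) auto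
  then have Lpos: "L \<noteq> 0" using exp_gt_zero[of "- (5 / 3) * (q / (1 - q))"] by linarith
  have shift: "(\<lambda>n. qpoch q (n + j)) \<longlonglongrightarrow> L" "(\<lambda>n. qpoch q (n - j)) \<longlonglongrightarrow> L"
    "(\<lambda>n. qpoch q (2 * n)) \<longlonglongrightarrow> L"
    using LIMSEQ_ignore_initial_segment[OF L(1)] filterlim_compose[OF L(1) filterlim_minus_const_nat_at_top]
      LIMSEQ_subseq_LIMSEQ[OF L(1), of "(*) 2"] by (auto simp: strict_mono_def o_def)
  have lim: "(\<lambda>n. qpoch q n * qpoch q (2 * n) / (qpoch q (n + j) * qpoch q (n - j))) \<longlonglongrightarrow> L * L / (L * L)"
    using Lpos by (intro tendsto_intros L shift) auto
  have "\<forall>\<^sub>F n in sequentially. qpoch q n * qpoch q (2 * n) / (qpoch q (n + j) * qpoch q (n - j)) =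
     theta_coeff q n (n + j)"
    using eventually_ge_at_top[of j] 
    by eventually_elim (auto simp: theta_coeff_def qbinomial_def mult_2)
  with lim show "(\<lambda>n. theta_coeff q n (n + j)) \<longlonglongrightarrow> 1"
    using Lpos by (auto elim: Lim_transform_eventually)
  have "\<forall>\<^sub>F n in sequentially. qpoch q n * qpoch q (2 * n) / (qpoch q (n + j) * qpoch q (n - j)) =
     theta_coeff q n (n - j)"
    using eventually_ge_at_top[of j] 
  proof eventually_elim
    case (elim n)
    then have "2 * n - (n - j) = n + j" by simp
    then show ?case using elim by (simp add: theta_coeff_def qbinomial_def mult.commute)
  qed
  with lim show "(\<lambda>n. theta_coeff q n (n - j)) \<longlonglongrightarrow> 1"
    using Lpos by (auto elim: Lim_transform_eventually)
qed

text \<open>Tannery's theorem, with the theta series itself as the dominating series; vanishing of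
  \<open>a n j\<close> for \<open>j > n\<close> turns the finite sums into full series.\<close>

lemma tendsto_partial_theta:
  assumes q: "0 < q" "q < 1"
    and a: "\<And>j. (\<lambda>n. a n j) \<longlonglongrightarrow> 1"
    and bound: "\<And>n j. 0 \<le> a n j \<and> a n j \<le> 1"
    and supp: "\<And>n j. j > n \<Longrightarrow> a n j = 0"
  shows "(\<lambda>n. \<Sum>j\<le>n. of_real (a n j * q ^ (j * (j + 1) div 2)) * z ^ j) \<longlonglongrightarrow> partial_theta q z"
proof -
  let ?M = "\<lambda>j. of_real (q ^ (j * (j + 1) div 2)) * z ^ j :: complex"
  let ?f = "\<lambda>j n. of_real (a n j) * ?M j"
  have sm: "summable (\<lambda>j. norm (?M j))"
    using summable_partial_theta[OF q, of "of_real (norm z)"] q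
    by (simp add: norm_mult norm_power flip: of_real_power of_real_mult)
  have "(\<lambda>n. suminf (\<lambda>j. ?f j n)) \<longlonglongrightarrow> suminf ?M"
  proof (rule tannerys_theorem[THEN conjunct2, THEN conjunct2])
    show "(\<lambda>n. ?f j n) \<longlonglongrightarrow> ?M j" for j
      using tendsto_mult[OF tendsto_of_real[OF a[of j], where ?'a = complex] tendsto_const[of "?M j"]] by simp
    have "norm (?f j n) \<le> norm (?M j)" for j n
      using bound[of n j] unfolding norm_mult[of "of_real (a n j)"] by (intro mult_left_le_one_le) auto
    then show "\<forall>\<^sub>F (j, n) in sequentially \<times>\<^sub>F sequentially. norm (?f j n) \<le> norm (?M j)"
      by (auto intro!: always_eventually)
  qed (use sm in auto)
  moreover have "suminf (\<lambda>j. ?f j n) = (\<Sum>j\<le>n. of_real (a n j * q ^ (j * (j + 1) div 2)) * z ^ j)" for n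
    by (subst suminf_finite[of "{..n}"]) (auto simp: supp not_le mult.assoc)
  ultimately show ?thesis by (simp add: partial_theta_def)
qed

theorem theta_prod_tendsto:
  assumes q: "0 < q" "q < 1" and z: "z \<noteq> 0"
  shows "theta_prod q z \<longlonglongrightarrow> partial_theta q z + partial_theta q (1 / z) / z"
proof -
  let ?a = "\<lambda>n j. if j \<le> n then theta_coeff q n (n + j) else 0"
  \<comment> \<open>The cut is strict: there are only \<open>n\<close> negative powers, and at
    \<open>j = n\<close> the index \<open>n - Suc j\<close> would truncate to 0.\<close>
  let ?b = "\<lambda>n j. if j < n then theta_coeff q n (n - Suc j) else 0"
  have ev: "\<forall>\<^sub>F n in sequentially. theta_coeff q n (n + j) = ?a n j" 
    "\<forall>\<^sub>F n in sequentially. theta_coeff q n (n - Suc j) = ?b n j" for j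
    using eventually_ge_at_top[of "Suc j"] by (eventually_elim; simp)+
  have "(\<lambda>n. \<Sum>j\<le>n. of_real (?a n j * q ^ (j * (j + 1) div 2)) * z ^ j) \<longlonglongrightarrow> partial_theta q z"
    using theta_coeff_bounds[OF q]
    by (intro tendsto_partial_theta q Lim_transform_eventually[OF theta_coeff_tendsto(1)[OF q] ev(1)]) auto
  moreover have "(\<lambda>n. \<Sum>j\<le>n. of_real (?b n j * q ^ (j * (j + 1) div 2)) * (1 / z) ^ j)
      \<longlonglongrightarrow> partial_theta q (1 / z)"
    using theta_coeff_bounds[OF q]
    by (intro tendsto_partial_theta q Lim_transform_eventually[OF theta_coeff_tendsto(2)[OF q] ev(2)]) auto
  ultimately have "(\<lambda>n. (\<Sum>j\<le>n. of_real (?a n j * q ^ (j * (j + 1) div 2)) * z ^ j) +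
      (\<Sum>j\<le>n. of_real (?b n j * q ^ (j * (j + 1) div 2)) * (1 / z) ^ j) / z)
      \<longlonglongrightarrow> partial_theta q z + partial_theta q (1 / z) / z"
    using z by (intro tendsto_add tendsto_divide tendsto_const)
  moreover have "(\<Sum>j\<le>n. of_real (?a n j * q ^ (j * (j + 1) div 2)) * z ^ j) +
      (\<Sum>j\<le>n. of_real (?b n j * q ^ (j * (j + 1) div 2)) * (1 / z) ^ j) / z = theta_prod q z n" for n
    unfolding theta_prod_eq_sum[OF q z] sum_divide_distrib
    by (intro arg_cong2[where f = "(+)"])
      (auto simp: lessThan_Suc_atMost[symmetric] power_divide intro!: sum.cong)
  ultimately show ?thesis by simp
qed

section \<open>Consequence of a zero, and numerical tools\<close>

text \<open>\<open>X\<close> is any eventual lower bound for the partial products: exponentials of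
  partial sums in the half-plane case, a constant in the strip case.\<close>

lemma partial_theta_zero_bound:
  assumes q: "0 < q" "q < 1" and z: "cmod z > 1" and zero: "partial_theta q z = 0"
    and X: "X \<longlonglongrightarrow> c" "\<forall>\<^sub>F n in sequentially. X n \<le> cmod (theta_prod q z n)"
  shows "c \<le> 1 / (cmod z - 1)"
proof -
  let ?w = "1 / z"
  have z0: "z \<noteq> 0" using z by auto
  have w: "norm (cmod ?w) < 1" using z by (simp add: norm_divide divide_simps)
  have "(\<lambda>n. cmod (theta_prod q z n)) \<longlonglongrightarrow> cmod (partial_theta q ?w / z)"
    using tendsto_norm[OF theta_prod_tendsto[OF q z0]] zero by simp
  then have "c \<le> cmod (partial_theta q ?w / z)"
    using X by (intro tendsto_le[OF sequentially_bot]) 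
  also have "\<dots> = cmod (partial_theta q ?w) / cmod z"
    by (rule norm_divide)
  also have "cmod (partial_theta q ?w) \<le> (\<Sum>j. cmod ?w ^ j)"
    unfolding partial_theta_def
  proof (rule norm_suminf_le)
    show "cmod (of_real (q ^ (j * (j + 1) div 2)) * ?w ^ j) \<le> cmod ?w ^ j" for j
      using q by (simp add: norm_mult norm_power mult_left_le_one_le power_le_one del: power_divide)
    show "summable (\<lambda>j. cmod ?w ^ j)" using w by (rule summable_geometric)
  qed
  also have "\<dots> = 1 / (1 - cmod ?w)" using w by (rule suminf_geometric)
  also have "1 / (1 - cmod ?w) / cmod z = 1 / (cmod z - 1)"
    using z z0 by (simp add: norm_divide field_simps)
  finally show ?thesis by (simp add: divide_right_mono)
qed

lemma exp_of_nat_le: "exp (real n) \<le> (2.72 :: real) ^ n"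
proof -
  have "exp (real n) = exp 1 ^ n" by (simp flip: exp_of_nat_mult)
  also have "\<dots> \<le> 2.72 ^ n" using e_less_272 by (intro power_mono) auto
  finally show ?thesis .
qed

text \<open>The odd exponents serve, by comparing squares, to bound \<open>exp\<close> at
  \<open>5 / 2\<close>, \<open>7 / 2\<close> and \<open>9 / 2\<close>.\<close>

lemma exp_numeral_bounds:
  "exp 4 \<le> (55 :: real)" "exp 5 \<le> (149 :: real)" "exp 7 \<le> (1102 :: real)" "exp 9 \<le> (8150 :: real)"
  using exp_of_nat_le[of 4] exp_of_nat_le[of 5] exp_of_nat_le[of 7] exp_of_nat_le[of 9]
  by (simp_all add: power_divide)

lemma cmod_theta_prod:
  assumes "0 < q" "q < 1"
  shows "cmod (theta_prod q z n) = qpoch q n * (\<Prod>k<n. cmod (1 + z * of_real (q ^ Suc k))) *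
    (\<Prod>k<n. cmod (1 + of_real (q ^ k) / z))"
proof -
  have "\<bar>1 - q ^ Suc k\<bar> = 1 - q ^ Suc k" for k
    using power_Suc_less_one[OF assms, of k] by simp
  then show ?thesis
    by (simp only: theta_prod_def qpoch_def prod_norm[symmetric] norm_mult norm_of_real prod.distrib)
qed

lemma geometric_power_sums:
  fixes q :: real
  assumes "0 < q" "q < 1" "0 < p"
  shows "(\<lambda>k. (q ^ Suc k) ^ p) sums (q ^ p / (1 - q ^ p))"
proof -
  have "(\<lambda>k. q ^ p * (q ^ p) ^ k) sums (q ^ p * (1 / (1 - q ^ p)))"
    using assms by (intro sums_mult geometric_sums) (auto simp: power_less_one_iff)
  then show ?thesis
    by (simp add: power_mult_distrib power_mult[symmetric] mult.commute)
qed

section \<open>The right half-plane\<close>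

text \<open>Here \<open>324 = 18 ^ 2\<close>. For small \<open>y\<close> the convex function
  \<open>exp\<close> lies below its chord on \<open>[0, 4]\<close>. For larger \<open>y\<close> the
  exponent never exceeds its maximum \<open>9 / 2\<close>, taken at \<open>y = 3 / 4\<close>, and
  \<open>98 < 1 + 324 * 3 / 10\<close>.\<close>

lemma exp_quadratic_le:
  fixes y :: real
  assumes "0 \<le> y" "y \<le> 1"
  shows "exp (12 * y - 8 * y\<^sup>2) \<le> 1 + 324 * y"
proof (cases "y \<le> 3 / 10")
  case True
  let ?t = "10 / 3 * y"
  have "12 * y - 8 * y\<^sup>2 \<le> ?t * 4"
    using assms zero_le_power2[of y] by linarith
  then have "exp (12 * y - 8 * y\<^sup>2) \<le> exp ((1 - ?t) *\<^sub>R 0 + ?t *\<^sub>R 4)"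
    by simp
  also have "\<dots> \<le> (1 - ?t) * exp 0 + ?t * exp 4"
    using True assms by (intro convex_onD[OF exp_convex]) auto
  also have "\<dots> \<le> (1 - ?t) * exp 0 + ?t * 55"
    using exp_numeral_bounds assms by (intro add_left_mono mult_left_mono) auto
  also have "\<dots> \<le> 1 + 324 * y" using assms by simp
  finally show ?thesis .
next
  case False
  have "(exp (9 / 2 :: real))\<^sup>2 \<le> 98\<^sup>2"
    using exp_numeral_bounds by (simp flip: exp_double)
  then have "exp (9 / 2 :: real) \<le> 98" by (rule power2_le_imp_le) simp
  moreover have "12 * y - 8 * y\<^sup>2 \<le> 9 / 2"
    using zero_le_power2[of "y - 3 / 4"] by (simp add: power2_eq_square algebra_simps)
  then have "exp (12 * y - 8 * y\<^sup>2) \<le> exp (9 / 2)" unfolding exp_le_cancel_iff .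
  ultimately show ?thesis using False by linarith
qed

text \<open>With \<open>s = q / (1 - q)\<close>, the sums of \<open>q ^ (2 * k)\<close> and \<open>q ^ (4 * k)\<close> over \<open>k \<ge> 1\<close> behave like
  \<open>s / 2\<close> and \<open>s / 4\<close> as \<open>q\<close> tends to 1, so this exponent gains \<open>2 * s\<close>, more than the \<open>5 / 3 * s\<close>
  lost in \<open>qpoch_ge\<close>.\<close>
lemma cmod_one_plus_right_half_plane:
  assumes "0 \<le> Re z" "18 \<le> cmod z" "0 \<le> x" "x \<le> 1"
  shows "exp (6 * x\<^sup>2 - 4 * x ^ 4) \<le> cmod (1 + z * of_real x)"
proof (rule power2_le_imp_le)
  have "(exp (6 * x\<^sup>2 - 4 * x ^ 4))\<^sup>2 = exp (12 * x\<^sup>2 - 8 * (x\<^sup>2)\<^sup>2)"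
    by (simp flip: exp_double)
  also have "\<dots> \<le> 1 + 324 * x\<^sup>2"
    using assms by (intro exp_quadratic_le) (auto simp: power_le_one)
  also have "\<dots> \<le> 1 + 2 * Re z * x + (cmod z)\<^sup>2 * x\<^sup>2"
  proof -
    have "324 * x\<^sup>2 \<le> (cmod z)\<^sup>2 * x\<^sup>2"
      using assms power_mono[of 18 "cmod z" 2] by (intro mult_right_mono) auto
    moreover have "0 \<le> 2 * Re z * x" using assms by simp
    ultimately show ?thesis by linarith
  qed
  also have "\<dots> = (cmod (1 + z * of_real x))\<^sup>2"
    unfolding cmod_power2 by (simp add: power2_eq_square algebra_simps)
  finally show "(exp (6 * x\<^sup>2 - 4 * x ^ 4))\<^sup>2 \<le> (cmod (1 + z * of_real x))\<^sup>2" .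
qed simp

text \<open>The factors \<open>1 + q ^ k / z\<close> have real part at least 1, so the product is at
  least \<open>exp (- (5 / 3) * s + ?H)\<close>; at a zero this would be below
  \<open>1 / 17\<close>.\<close>

lemma partial_theta_nonzero_right:
  assumes q: "0 < q" "q < 1" and z: "0 \<le> Re z" "18 < cmod z"
  shows "partial_theta q z \<noteq> 0"
proof
  assume zero: "partial_theta q z = 0"
  define s where "s = q / (1 - q)"
  let ?h = "\<lambda>k. 6 * (q ^ Suc k)\<^sup>2 - 4 * (q ^ Suc k) ^ 4"
  let ?H = "6 * (q\<^sup>2 / (1 - q\<^sup>2)) - 4 * (q ^ 4 / (1 - q ^ 4))"
  have xk: "0 \<le> q ^ k" "q ^ k \<le> 1" for k using q by (auto simp: power_le_one)
  have "?h sums ?H"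
    using q by (intro sums_diff sums_mult geometric_power_sums) auto
  then have lim: "(\<lambda>n. exp (- (5 / 3) * s) * exp (sum ?h {..<n})) \<longlonglongrightarrow> exp (- (5 / 3) * s) * exp ?H"
    unfolding sums_def by (intro tendsto_mult tendsto_exp tendsto_const)
  have "exp (- (5 / 3) * s) * exp (sum ?h {..<n}) \<le> cmod (theta_prod q z n)" for n
  proof -
    have "exp (sum ?h {..<n}) \<le> (\<Prod>k<n. cmod (1 + z * of_real (q ^ Suc k)))"
      unfolding exp_sum[OF finite_lessThan]
      using z xk by (intro prod_mono conjI cmod_one_plus_right_half_plane) (auto simp del: power_Suc)
    moreover have "1 \<le> (\<Prod>k<n. cmod (1 + of_real (q ^ k) / z))"
    proof (rule prod_ge_1)
      fix k
      have "0 \<le> Re (of_real (q ^ k) / z)"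
        using z xk[of k] by (simp add: Re_divide del: of_real_power)
      then show "1 \<le> cmod (1 + of_real (q ^ k) / z)"
        using complex_Re_le_cmod[of "1 + of_real (q ^ k) / z"] by simp
    qed
    ultimately have "exp (- (5 / 3) * s) * exp (sum ?h {..<n}) * 1 \<le> cmod (theta_prod q z n)"
      unfolding cmod_theta_prod[OF q] s_def
      using qpoch_pos[OF q, of n] by (intro mult_mono qpoch_ge q) (auto intro!: prod_nonneg mult_nonneg_nonneg less_imp_le[OF qpoch_pos[OF q]])
    then show ?thesis by simp
  qed
  then have "exp (- (5 / 3) * s) * exp ?H \<le> 1 / (cmod z - 1)"
    using z by (intro partial_theta_zero_bound[OF q _ zero lim] always_eventually) auto
  also have "\<dots> < 1 / 17" using z by (simp add: divide_simps)
  finally have upper: "exp (- (5 / 3) * s + ?H) < 1 / 17" by (simp only: exp_add)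
  have q2: "q\<^sup>2 < 1" "q ^ 4 < 1" using q by (auto simp: power_less_one_iff)
  have e: "q / (1 - q) = (q + q\<^sup>2 + q ^ 3 + q ^ 4) / (1 - q ^ 4)"
    "q\<^sup>2 / (1 - q\<^sup>2) = (q\<^sup>2 + q ^ 4) / (1 - q ^ 4)"
    using q q2 by (simp_all add: divide_simps) (simp_all add: power_numeral_reduce algebra_simps)
  have frac: "6 * (b / d) - 4 * (c / d) = (6 * b - 4 * c) / d"
    "- (5 / 3) * (a / d) + b / d = (b - 5 / 3 * a) / d" for a b c d :: real
    by (simp_all add: diff_divide_distrib add_divide_distrib)
  have num: "6 * (q\<^sup>2 + q ^ 4) - 4 * q ^ 4 = 6 * q\<^sup>2 + 2 * q ^ 4" by simp
  have H: "?H = (6 * q\<^sup>2 + 2 * q ^ 4) / (1 - q ^ 4)"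
    "- (5 / 3) * s + ?H = (6 * q\<^sup>2 + 2 * q ^ 4 - 5 / 3 * (q + q\<^sup>2 + q ^ 3 + q ^ 4)) / (1 - q ^ 4)"
    unfolding s_def e frac num by (rule refl)+
  show False
  \<comment> \<open>For \<open>q\<close> up to \<open>3 / 5\<close> the crude bounds
    \<open>s \<le> 3 / 2\<close> and \<open>?H \<ge> 0\<close> suffice, as
    \<open>exp (5 / 2) \<le> 17\<close>. Beyond that the whole exponent is nonnegative.\<close>
  proof (cases "q \<le> 3 / 5")
    case True
    then have "s \<le> 3 / 2" using q by (simp add: s_def divide_simps)
    moreover have "0 \<le> ?H" unfolding H(1) using q q2 by simp
    ultimately have "exp (- (5 / 2)) \<le> exp (- (5 / 3) * s + ?H)" by simp
    moreover have "(exp (5 / 2 :: real))\<^sup>2 \<le> 17\<^sup>2"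
      using exp_numeral_bounds by (simp flip: exp_double)
    then have "exp (5 / 2 :: real) \<le> 17" by (rule power2_le_imp_le) simp
    then have "1 / 17 \<le> exp (- (5 / 2) :: real)" by (simp add: exp_minus divide_simps)
    ultimately show False using upper by linarith
  next
    case False
    \<comment> \<open>The numerator of the exponent, regrouped so that every summand is visibly
      nonnegative for \<open>3 / 5 < q < 1\<close>.\<close>
    have "0 \<le> q * ((q - 3 / 5) * (13 / 3 - 5 / 3 * (q + 3 / 5)) + q ^ 3 / 3 + 1 / 3)"
      using False q by (intro mult_nonneg_nonneg add_nonneg_nonneg) auto
    also have "\<dots> = 6 * q\<^sup>2 + 2 * q ^ 4 - 5 / 3 * (q + q\<^sup>2 + q ^ 3 + q ^ 4)"
      by (simp add: power_numeral_reduce field_simps)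
    finally have "0 \<le> - (5 / 3) * s + ?H" unfolding H(2) using q2 by simp
    then have "1 \<le> exp (- (5 / 3) * s + ?H)" unfolding one_le_exp_iff .
    with upper show False by linarith
  qed
qed

section \<open>The region where the imaginary part exceeds 132 in absolute value\<close>

text \<open>The third bound is the distance from the origin to the line through 1 in direction
  \<open>z\<close>; it is used where \<open>cmod z * x\<close> is close to 1 and the triangle
  inequalities give nothing.\<close>

lemma cmod_one_plus_ge:
  fixes z :: complex and x :: real
  shows "cmod z * x - 1 \<le> cmod (1 + z * of_real x)"
    and "0 \<le> x \<Longrightarrow> 1 - cmod z * x \<le> cmod (1 + z * of_real x)"
    and "\<bar>Im z\<bar> / cmod z \<le> cmod (1 + z * of_real x)"
proof -
  have "cmod (z * of_real x) \<le> cmod (1 + z * of_real x) + 1"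
    using norm_triangle_ineq4[of "1 + z * of_real x" 1] by simp
  moreover have "cmod z * x \<le> cmod (z * of_real x)"
    by (simp add: norm_mult mult_left_mono)
  ultimately show "cmod z * x - 1 \<le> cmod (1 + z * of_real x)" by linarith
  show "1 - cmod z * x \<le> cmod (1 + z * of_real x)" if "0 \<le> x"
    using norm_diff_ineq[of 1 "z * of_real x"] that by (simp add: norm_mult)
  \<comment> \<open>Multiplication by \<open>cnj z\<close> makes the term with \<open>x\<close>
    real, so \<open>x\<close> drops out of the imaginary part.\<close>
  have "\<bar>Im z\<bar> = \<bar>Im ((1 + z * of_real x) * cnj z)\<bar>"
    by (simp add: algebra_simps)
  also have "\<dots> \<le> cmod (1 + z * of_real x) * cmod z"
    using abs_Im_le_cmod[of "(1 + z * of_real x) * cnj z"] by (simp only: norm_mult complex_mod_cnj)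
  finally show "\<bar>Im z\<bar> / cmod z \<le> cmod (1 + z * of_real x)"
    by (cases "z = 0") (simp_all add: divide_simps)
qed

lemma pos_power_threshold:
  fixes q R :: real
  assumes "0 < q" "q < 1" "1 < R"
  obtains m where "1 \<le> R * q ^ m" "R * q ^ Suc m < 1"
proof -
  have "\<exists>k. q ^ k < 1 / R"
    using assms by (intro real_arch_pow_inv) auto
  then obtain k where "R * q ^ k < 1" using assms by (auto simp: field_simps)
  moreover have "\<not> R * q ^ 0 < 1" using assms by simp
  ultimately obtain m where "\<not> R * q ^ m < 1" "R * q ^ Suc m < 1"
    using ex_least_nat_less[of "\<lambda>k. R * q ^ k < 1" k] by auto
  then show ?thesis by (intro that) auto
qed

text \<open>Stated for arbitrary factors so that it covers both the indices beyond the critical pair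
  and, after normalising and reversing, those before it.\<close>

lemma qpoch_le_prod:
  fixes F :: "nat \<Rightarrow> real"
  assumes q: "0 < q" "q < 1" and F: "\<And>k. k < n \<Longrightarrow> 1 - q ^ Suc k \<le> F k"
  shows "exp (- (5 / 3) * (q / (1 - q))) \<le> (\<Prod>k<n. F k)"
proof -
  have "qpoch q n \<le> (\<Prod>k<n. F k)"
    unfolding qpoch_def
    using F power_Suc_less_one[OF q] by (intro prod_mono conjI) (auto simp: less_imp_le)
  then show ?thesis using qpoch_ge[OF q, of n] by linarith
qed

text \<open>The index \<open>m\<close> is where \<open>cmod z * q ^ m\<close> crosses 1. Away from \<open>m\<close> and \<open>m + 1\<close> the factors are
  dominated by those of two copies of \<open>qpoch\<close>; of the two critical factors one is at least
  \<open>(1 - q) / 2\<close>, and both are at least the sine of the argument of \<open>z\<close>.\<close>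
lemma prod_cmod_ge:
  assumes q: "0 < q" "q < 1"
    and m: "1 \<le> cmod z * q ^ m" "cmod z * q ^ Suc m < 1" and n: "m < n"
  shows "exp (- (5 / 3) * (q / (1 - q))) * exp (- (5 / 3) * (q / (1 - q))) *
      (\<bar>Im z\<bar> / cmod z * ((1 - q) / 2)) * (\<Prod>k<m - 1. cmod z * q ^ Suc k)
    \<le> (\<Prod>k<n. cmod (1 + z * of_real (q ^ Suc k)))"
proof -
  let ?R = "cmod z"
  let ?F = "\<lambda>i. cmod (1 + z * of_real (q ^ i))"
  define y where "y = \<bar>Im z\<bar> / cmod z"
  define E where "E = exp (- (5 / 3) * (q / (1 - q)))"
  have pw: "0 < q ^ i" for i using q by simp
  have R0: "0 < ?R" using m(1) by (cases "z = 0") auto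
  have E: "0 < E" "E \<le> 1" using q by (auto simp: E_def)
  have y0: "0 \<le> y" by (simp add: y_def)
  have tail: "E \<le> (\<Prod>j<d. ?F (m + 2 + j))" for d
  proof (unfold E_def, rule qpoch_le_prod[OF q])
    fix j
    have "?R * q ^ (m + 2 + j) = (?R * q ^ Suc m) * q ^ Suc j"
      by (simp add: power_add)
    also have "\<dots> \<le> q ^ Suc j"
      using m(2) pw[of "Suc j"] by (intro mult_left_le_one_le) (auto simp: R0 less_imp_le pw simp del: power_Suc)
    finally show "1 - q ^ Suc j \<le> ?F (m + 2 + j)"
      using cmod_one_plus_ge(2)[of "q ^ (m + 2 + j)" z] pw[of "m + 2 + j"] by linarith
  qed
  have ymin: "y \<le> ?F i" for i unfolding y_def by (rule cmod_one_plus_ge)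
  have "E * E * (y * ((1 - q) / 2)) * (\<Prod>k<m - 1. ?R * q ^ Suc k) \<le> (\<Prod>k<n. ?F (Suc k))"
  proof (cases m)
    \<comment> \<open>The product starts at index 1, so only the critical factor \<open>?F 1\<close>
      occurs; the surplus \<open>E\<close> and \<open>(1 - q) / 2\<close> are at most 1.\<close>
    case 0
    obtain d where d: "n = Suc d" using n by (cases n) auto
    have "E * E * (y * ((1 - q) / 2)) \<le> 1 * E * (y * 1)"
      using E q y0 by (intro mult_mono mult_nonneg_nonneg) auto
    also have "\<dots> \<le> (\<Prod>j<d. ?F (2 + j)) * ?F 1"
      using E tail[of d] ymin[of 1] 0 y0 by (intro mult_mono) (auto intro: prod_nonneg)
    also have "\<dots> = (\<Prod>k<n. ?F (Suc k))"
      unfolding d prod.lessThan_Suc_shift by (simp add: mult.commute)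
    finally show ?thesis using 0 by simp
  next
    case (Suc p)
    obtain d where d: "n = p + 2 + d"
      using n Suc less_imp_Suc_add[of m n] by auto
    let ?P = "\<Prod>k<p. ?R * q ^ Suc k"
    \<comment> \<open>A factor divided by \<open>?R * q ^ i\<close> is at least
      \<open>1 - 1 / (?R * q ^ i)\<close>, hence at least \<open>1 - q ^ (m - i)\<close> because
      \<open>?R * q ^ m \<ge> 1\<close>. Reversing the order turns \<open>m - i\<close> into
      \<open>Suc k\<close>.\<close>
    have head: "E * ?P \<le> (\<Prod>k<p. ?F (Suc k))"
    proof -
      have "E \<le> (\<Prod>k<p. ?F (Suc (p - Suc k)) / (?R * q ^ Suc (p - Suc k)))"
      proof (unfold E_def, rule qpoch_le_prod[OF q])
        fix k assume k: "k < p"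
        let ?i = "Suc (p - Suc k)"
        have e: "q ^ m = q ^ ?i * q ^ Suc k"
          unfolding power_add[symmetric] using k Suc by simp
        have "1 - q ^ Suc k \<le> (?R * q ^ ?i - 1) / (?R * q ^ ?i)"
        proof -
          have aux: "1 - w \<le> (v - 1) / v" if "0 < v" "1 \<le> v * w" for v w :: real
            using that by (simp add: field_simps)
          show ?thesis using m(1) R0 pw[of ?i] unfolding e by (intro aux) (simp_all add: mult.assoc)
        qed
        also have "\<dots> \<le> ?F ?i / (?R * q ^ ?i)"
          using cmod_one_plus_ge(1)[of z "q ^ ?i"] R0 pw[of ?i] by (intro divide_right_mono) auto
        finally show "1 - q ^ Suc k \<le> ?F ?i / (?R * q ^ ?i)" .
      qed
      also have "\<dots> = (\<Prod>k<p. ?F (Suc k) / (?R * q ^ Suc k))"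
        by (rule prod.nat_diff_reindex)
      also have "\<dots> = (\<Prod>k<p. ?F (Suc k)) / ?P" by (rule prod_dividef)
      finally show ?thesis
        using R0 pw by (subst (asm) pos_le_divide_eq) (auto intro!: prod_pos simp del: power_Suc)
    qed
    have crit: "y * ((1 - q) / 2) \<le> ?F m * ?F (Suc m)"
    proof -
      \<comment> \<open>The triangle bounds of the two critical factors add up to
        \<open>?R * q ^ m * (1 - q)\<close>, so one factor is at least \<open>(1 - q) / 2\<close>;
        the other is bounded by \<open>y\<close>.\<close>
      have "1 - q \<le> (?R * q ^ m) * (1 - q)" using m(1) q by simp
      also have "\<dots> = (?R * q ^ m - 1) + (1 - ?R * q ^ Suc m)" by (simp add: algebra_simps)
      also have "\<dots> \<le> ?F m + ?F (Suc m)"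
        using pw[of "Suc m"] by (intro add_mono cmod_one_plus_ge) auto
      finally have "1 - q \<le> ?F m + ?F (Suc m)" .
      moreover have "c / 2 \<le> a \<or> c / 2 \<le> b" if "c \<le> a + b" for a b c :: real
        using that by auto
      ultimately consider "(1 - q) / 2 \<le> ?F m" | "(1 - q) / 2 \<le> ?F (Suc m)" by blast
      then show ?thesis
      proof cases
        case 1
        then have "(1 - q) / 2 * y \<le> ?F m * ?F (Suc m)"
          using y0 q by (intro mult_mono ymin) auto
        then show ?thesis by (simp only: mult.commute)
      next
        case 2
        then show ?thesis
          using y0 q by (intro mult_mono ymin) auto
      qed
    qed
    have "E * E * (y * ((1 - q) / 2)) * ?P = (E * ?P) * (y * ((1 - q) / 2)) * E"
      by (simp only: mult_ac)
    also have "\<dots> \<le> (\<Prod>k<p. ?F (Suc k)) * (?F m * ?F (Suc m)) * (\<Prod>j<d. ?F (m + 2 + j))"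
      using E y0 q by (intro mult_mono head crit tail) (auto intro!: prod_nonneg mult_nonneg_nonneg)
    also have "\<dots> = (\<Prod>k<n. ?F (Suc k))"
      unfolding d prod_lessThan_add by (simp add: Suc numeral_2_eq_2)
    finally show ?thesis using Suc by simp
  qed
  then show ?thesis unfolding E_def y_def .
qed

text \<open>For \<open>0 \<le> u \<le> 1\<close> one has
  \<open>1 - u / 132 \<ge> exp (- u / 131)\<close>; the exponents then form a geometric
  series.\<close>

lemma prod_one_plus_inverse_ge:
  assumes q: "0 < q" "q < 1" and z: "132 \<le> cmod z"
  shows "exp (- (1 / (1 - q)) / 131) \<le> (\<Prod>k<n. cmod (1 + of_real (q ^ k) / z))"
proof -
  have "exp (- (1 / (1 - q)) / 131) \<le> exp (\<Sum>k<n. - (q ^ k) / 131)"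
  proof -
    have "(\<Sum>k<n. q ^ k) = (1 - q ^ n) / (1 - q)" using q by (simp add: sum_gp_strict)
    also have "\<dots> \<le> 1 / (1 - q)" using q by (intro divide_right_mono) auto
    finally have "(\<Sum>k<n. q ^ k) / 131 \<le> 1 / (1 - q) / 131" by (rule divide_right_mono) simp
    moreover have "(\<Sum>k<n. - (q ^ k) / 131) = - ((\<Sum>k<n. q ^ k) / 131)"
      by (simp add: sum_negf sum_divide_distrib)
    ultimately show ?thesis by simp
  qed
  also have "\<dots> \<le> (\<Prod>k<n. cmod (1 + of_real (q ^ k) / z))"
    unfolding exp_sum[OF finite_lessThan]
  proof (intro prod_mono conjI)
    fix k
    let ?u = "q ^ k"
    have u: "0 < ?u" "?u \<le> 1" using q by (auto simp: power_le_one)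
    have "1 \<le> (1 + ?u / 131) * (1 - ?u / 132)"
    proof -
      have "(1 + ?u / 131) * (1 - ?u / 132) - 1 = ?u * (1 - ?u) / (131 * 132)"
        by (simp add: field_simps)
      moreover have "0 \<le> ?u * (1 - ?u) / (131 * 132)" using u by simp
      ultimately show ?thesis by linarith
    qed
    also have "\<dots> \<le> exp (?u / 131) * (1 - ?u / 132)"
      using u by (intro mult_right_mono exp_ge_add_one_self) auto
    finally have "exp (- ?u / 131) \<le> 1 - ?u / 132"
      by (simp add: exp_minus field_simps)
    also have "\<dots> \<le> 1 - ?u / cmod z"
      using u z frac_le[of ?u ?u 132 "cmod z"] by simp
    also have "\<dots> \<le> cmod (1 + of_real ?u / z)"
      using norm_diff_ineq[of 1 "of_real ?u / z"]
      unfolding norm_divide norm_of_real norm_one abs_of_pos[OF u(1)] .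
    finally show "exp (- ?u / 131) \<le> cmod (1 + of_real ?u / z)" .
  qed auto
  finally show ?thesis .
qed

text \<open>In logarithms the product is an arithmetic progression of \<open>m - 1\<close> terms
  with mean \<open>L - m * t / 2\<close>, which is at least \<open>L / 2\<close> and so at least
  \<open>9 / 4\<close>. Also \<open>m - 1 > L / t - 2\<close>, which is at least
  \<open>9 / 2 * s - 2\<close>; multiplying gives \<open>81 / 8 * s - 9 / 2\<close>.\<close>

lemma prod_large_factors_ge:
  fixes R q s :: real
  assumes q: "0 < q" "q < 1" and R: "132 \<le> R"
    and m: "1 \<le> R * q ^ m" "R * q ^ Suc m < 1"
  defines "s \<equiv> q / (1 - q)"
  shows "1 \<le> (\<Prod>k<m - 1. R * q ^ Suc k)"
    and "2 / 3 \<le> s \<Longrightarrow> exp (81 / 8 * s - 9 / 2) \<le> (\<Prod>k<m - 1. R * q ^ Suc k)"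
proof -
  show "1 \<le> (\<Prod>k<m - 1. R * q ^ Suc k)"
  proof (rule prod_ge_1)
    fix k assume "k \<in> {..<m - 1}"
    then have "q ^ m \<le> q ^ Suc k" using q by (intro power_decreasing) auto
    then have "R * q ^ m \<le> R * q ^ Suc k" using R by (intro mult_left_mono) auto
    then show "1 \<le> R * q ^ Suc k" using m(1) by linarith
  qed
  assume s: "2 / 3 \<le> s"
  define L t where "L = ln R" and "t = - ln q"
  have t0: "0 < t" using q by (simp add: t_def)
  have Rq: "R * q ^ k = exp (L - real k * t)" for k
    using R q by (simp add: L_def t_def exp_add exp_of_nat_mult)
  have L: "9 / 2 \<le> L"
  proof -
    have "(exp (9 / 2 :: real))\<^sup>2 \<le> 132\<^sup>2"
      using exp_numeral_bounds by (simp flip: exp_double)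
    then have "exp (9 / 2 :: real) \<le> 132" by (rule power2_le_imp_le) simp
    then have "exp (9 / 2) \<le> R" using R by linarith
    then show ?thesis using R by (simp only: L_def ln_ge_iff)
  qed
  have mt: "real m * t \<le> L" "L < (real m + 1) * t"
    using m unfolding Rq by (simp_all add: add.commute)
  \<comment> \<open>From \<open>ln (1 / q) \<le> 1 / q - 1 = 1 / s\<close>.\<close>
  have st: "s \<le> 1 / t"
  proof -
    have "t \<le> 1 / s" using ln_le_minus_one[of "1 / q"] q
      by (simp add: t_def s_def ln_div field_simps)
    then show ?thesis using t0 s by (simp add: field_simps)
  qed
  have "9 / 2 * s \<le> L * (1 / t)" using L st s by (intro mult_mono) auto
  also have "\<dots> < real m + 1" using mt(2) t0 by (simp add: divide_simps)
  finally have ms: "9 / 2 * s - 2 < real m - 1" by simp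
  obtain p where p: "m = Suc p" using ms s by (cases m) auto
  have "(\<Prod>k<j. R * q ^ Suc k) = exp (real j * (L - real (Suc j) * t / 2))" for j
    unfolding Rq by (induction j) (auto simp: field_simps simp flip: exp_add)
  then have "(\<Prod>k<m - 1. R * q ^ Suc k) = exp (real p * (L - real m * t / 2))"
    unfolding p by simp
  moreover have "9 / 4 \<le> L - real m * t / 2" using mt(1) L by linarith
  then have "(9 / 2 * s - 2) * (9 / 4) \<le> real p * (L - real m * t / 2)"
    using ms p s by (intro mult_mono) auto
  ultimately show "exp (81 / 8 * s - 9 / 2) \<le> (\<Prod>k<m - 1. R * q ^ Suc k)"
    by (simp add: algebra_simps)
qed

text \<open>The final balance: \<open>5 * s\<close> collects the three losses of
  \<open>5 / 3 * s\<close>, \<open>(1 + s) / 131\<close> comes from the factors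
  \<open>1 + q ^ k / z\<close>, and \<open>1 + s\<close> is \<open>1 / (1 - q)\<close>.\<close>

lemma exp_growth_less:
  fixes s P :: real
  assumes s: "0 \<le> s" and P: "1 \<le> P"
    and large: "2 / 3 \<le> s \<Longrightarrow> exp (81 / 8 * s - 9 / 2) \<le> P"
  shows "(1 + s) * exp (5 * s + (1 + s) / 131) < 131 / 2 * P"
proof (cases "2 / 3 \<le> s")
  case True
  have "(1 + s) * exp (5 * s + (1 + s) / 131) \<le> exp s * exp (5 * s + (1 + s) / 131)"
    by (intro mult_right_mono exp_ge_add_one_self) auto
  also have "\<dots> = exp (6 * s + (1 + s) / 131)" by (simp flip: exp_add)
  also have "\<dots> \<le> exp (4 + (81 / 8 * s - 9 / 2))"
    unfolding exp_le_cancel_iff using True by (simp add: field_simps)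
  also have "\<dots> = exp 4 * exp (81 / 8 * s - 9 / 2)" by (rule exp_add)
  also have "\<dots> \<le> 55 * P"
    using exp_numeral_bounds large[OF True] by (intro mult_mono) auto
  also have "\<dots> < 131 / 2 * P" using P by simp
  finally show ?thesis .
next
  case False
  have "(exp (7 / 2 :: real))\<^sup>2 \<le> 39\<^sup>2"
    using exp_numeral_bounds by (simp flip: exp_double)
  then have e: "exp (7 / 2 :: real) \<le> 39" by (rule power2_le_imp_le) simp
  \<comment> \<open>This is the tight case: \<open>5 / 3 * 39 = 65\<close> just fits below
    \<open>131 / 2\<close>.\<close>
  have "(1 + s) * exp (5 * s + (1 + s) / 131) \<le> (5 / 3) * exp (7 / 2)"
    using s False by (intro mult_mono) (auto simp: field_simps)
  also have "\<dots> < 131 / 2 * P" using e P by simp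
  finally show ?thesis .
qed

lemma partial_theta_nonzero_strip:
  assumes q: "0 < q" "q < 1" and z: "132 < \<bar>Im z\<bar>"
  shows "partial_theta q z \<noteq> 0"
proof
  assume zero: "partial_theta q z = 0"
  define s R where "s = q / (1 - q)" and "R = cmod z"
  have R: "132 < R" using z abs_Im_le_cmod[of z] by (simp add: R_def)
  have s0: "0 \<le> s" "1 / (1 - q) = 1 + s" "1 - q = 1 / (1 + s)"
    using q by (simp_all add: s_def field_simps)
  obtain m where m: "1 \<le> R * q ^ m" "R * q ^ Suc m < 1"
    using pos_power_threshold[OF q, of R] R by auto
  let ?P = "\<Prod>k<m - 1. R * q ^ Suc k"
  let ?E = "exp (- (5 / 3) * s)"
  let ?y = "\<bar>Im z\<bar> / R * ((1 - q) / 2)"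
  let ?c = "?E * (?E * ?E * ?y * ?P) * exp (- (1 + s) / 131)"
  have P: "1 \<le> ?P" using prod_large_factors_ge(1)[OF q _ m] R by simp
  have y0: "0 \<le> ?y" using R q by simp
  have prod0: "0 \<le> ?E * ?E * ?y * ?P"
    by (intro mult_nonneg_nonneg exp_ge_zero y0) (use P in linarith)
  have "\<forall>\<^sub>F n in sequentially. ?c \<le> cmod (theta_prod q z n)"
    using eventually_gt_at_top[of m]
  proof eventually_elim
    case (elim n)
    show ?case
      unfolding cmod_theta_prod[OF q]
    proof (intro mult_mono)
      show "?E \<le> qpoch q n" unfolding s_def by (rule qpoch_ge[OF q])
      show "?E * ?E * ?y * ?P \<le> (\<Prod>k<n. cmod (1 + z * of_real (q ^ Suc k)))"
        unfolding s_def R_def by (rule prod_cmod_ge[OF q m[unfolded R_def] elim])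
      show "exp (- (1 + s) / 131) \<le> (\<Prod>k<n. cmod (1 + of_real (q ^ k) / z))"
        unfolding s0(2)[symmetric] using R by (intro prod_one_plus_inverse_ge[OF q]) (simp add: R_def)
      show "0 \<le> qpoch q n" using qpoch_pos[OF q] by (rule less_imp_le)
      then show "0 \<le> qpoch q n * (\<Prod>k<n. cmod (1 + z * of_real (q ^ Suc k)))"
        by (intro mult_nonneg_nonneg prod_nonneg) auto
    qed (use prod0 in auto)
  qed
  then have "?c \<le> 1 / (R - 1)"
    unfolding R_def using R[unfolded R_def]
    by (intro partial_theta_zero_bound[OF q _ zero tendsto_const]) auto
  moreover have "?c = \<bar>Im z\<bar> / R * ?P / (2 * (1 + s)) * exp (- (5 * s + (1 + s) / 131))"
  proof -
    have "exp (- (5 * s + (1 + s) / 131)) = ?E * (?E * ?E) * exp (- (1 + s) / 131)"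
      unfolding exp_add[symmetric] by (simp add: field_simps)
    then show ?thesis unfolding s0(3) by (simp add: mult_ac)
  qed
  moreover have "1 / (R - 1) < \<bar>Im z\<bar> / R * ?P / (2 * (1 + s)) * exp (- (5 * s + (1 + s) / 131))"
  proof -
    \<comment> \<open>After clearing denominators this says exactly \<open>R > 132\<close>.\<close>
    have "131 / (R - 1) < 132 / R" using R by (simp add: field_simps)
    also have "\<dots> \<le> \<bar>Im z\<bar> / R" using z R by (intro divide_right_mono) auto
    finally have "131 / (R - 1) \<le> \<bar>Im z\<bar> / R" by simp
    moreover have "1 < 131 * ?P / (2 * (1 + s)) * exp (- (5 * s + (1 + s) / 131))"
    proof -
      have aux: "1 < 131 * p / (2 * a) * inverse x" if "a * x < 131 / 2 * p" "0 < a" "0 < x" for a p x :: real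
        using that by (simp add: field_simps)
      show ?thesis
        unfolding exp_minus using R s0(1)
        by (intro aux exp_growth_less[OF s0(1) P prod_large_factors_ge(2)[OF q _ m, folded s_def]]) auto
    qed
    ultimately have "1 / 131 * (131 / (R - 1)) * 1 <
      1 / 131 * (\<bar>Im z\<bar> / R) * (131 * ?P / (2 * (1 + s)) * exp (- (5 * s + (1 + s) / 131)))"
      using R z by (intro mult_le_less_imp_less mult_left_mono) auto
    then show ?thesis by simp
  qed
  ultimately show False by simp
qed

theorem theorem1:
  shows "(\<forall>q::real. 0 < q \<and> q < 1 \<longrightarrow>
            (\<forall>z::complex. Re z \<ge> 0 \<and> partial_theta q z = 0 \<longrightarrow>
               z \<in> {z. Re z \<ge> 0 \<and> cmod z \<le> 18})) \<and>
         (\<forall>q::real. 0 < q \<and> q < 1 \<longrightarrow>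
            (\<forall>z::complex. Re z < 0 \<and> partial_theta q z = 0 \<longrightarrow>
               z \<in> {z. Re z < 0 \<and> \<bar>Im z\<bar> \<le> 132}))"
  using partial_theta_nonzero_right partial_theta_nonzero_strip by (auto simp: not_le[symmetric])

end
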